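(* Consider the anisotropic ROF model $\min_{u\in\mathbb{R}^n}\frac12\|u-z\|_2^2+\alpha\|\nabla u\|_1$ with the anisotropic norm $\|p\|_1=\sum_{i=1}^m(|p_i^1|+|p_i^2|)$, and let $$l(u,p,\lambda)=\tfrac12\langle u,u\rangle-\langle u,z\rangle+\tfrac12\|z\|_2^2+\alpha\|p\|_1+\langle\nabla u-p,\lambda\rangle,\qquad u\in\mathbb{R}^n,\ p,\lambda\in\mathbb{R}^{2m},$$ be its Lagrangian (with the constraint $p=\nabla u$). Let $T_l$ be the associated maximal monotone KKT operator, $T_l(u,p,\lambda)=\{(u',p',\lambda') : (u',p',-\lambda')\in\partial l(u,p,\lambda)\}$. Assume that the KKT system has at least one solution $(\bar u,\bar p,\bar\lambda)$, i.e. $0\in T_l(\bar u,\bar p,\bar\lambda)$. Then $T_l$ is metrically subregular at $(\bar u,\bar p,\bar\lambda)^T$ for the origin.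
   Context: All spaces are finite dimensional Euclidean spaces; $\alpha>0$ and $z\in\mathbb{R}^n$ is the given data (noisy image). $\nabla_1,\nabla_2\in\mathbb{R}^{m\times n}$ are the matrices of the discrete forward-difference operators on a pixel grid (with homogeneous Neumann boundary conditions), and $\nabla u\in\mathbb{R}^{2m}$ has blocks $(\nabla u)_i=((\nabla_1u)_i,(\nabla_2u)_i)^T\in\mathbb{R}^2$, $i=1,\dots,m$; $\nabla^*$ is the adjoint of $\nabla$. Vectors $p\in\mathbb{R}^{2m}$ are written $p=(p_1,\dots,p_m)^T$, $p_i=(p_i^1,p_i^2)^T\in\mathbb{R}^2$, and similarly for $\lambda$. $l$ is convex in $(u,p)$ and concave (affine) in $\lambda$; $\partial l(u,p,\lambda)$ is the convex-concave subdifferential (subgradients in $(u,p)$, supergradients in $\lambda$), so that $T_l(u,p,\lambda)=\{u-z+\nabla^*\lambda\}\times(-\lambda+\alpha\,\partial\|\cdot\|_1(p))\times\{p-\nabla u\}$. Metric subregularity: a set-valued map $F:X\rightrightarrows Y$ is metrically subregular at $\bar x$ for $\bar y$ if $\bar y\in F(\bar x)$ and there exist a modulus $\kappa\ge0$ and neighborhoods $U$ of $\bar x$ and $V$ of $\bar y$ such that $\mathrm{dist}(x,F^{-1}(\bar y))\le\kappa\,\mathrm{dist}(\bar y,F(x)\cap V)$ for all $x\in U$ (with $\mathrm{dist}(\cdot,\emptyset)=+\infty$). *)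

theory Defs
  imports "HOL-Analysis.Analysis"
begin

section \<open>Subdifferentials\<close>

definition subdifferential :: "('a::real_inner \<Rightarrow> real) \<Rightarrow> 'a \<Rightarrow> 'a set" where
  "subdifferential f x = {g. \<forall>y. f y \<ge> f x + g \<bullet> (y - x)}"

definition superdifferential :: "('a::real_inner \<Rightarrow> real) \<Rightarrow> 'a \<Rightarrow> 'a set" where
  "superdifferential f x = {g. \<forall>y. f y \<le> f x + g \<bullet> (y - x)}"

text \<open>Convex-concave subdifferential of a saddle function \<open>L x y\<close>, convex in \<open>x\<close> and concave
  in \<open>y\<close>.\<close>

definition saddle_subdifferential ::
    "('a::real_inner \<Rightarrow> 'b::real_inner \<Rightarrow> real) \<Rightarrow> 'a \<Rightarrow> 'b \<Rightarrow> ('a \<times> 'b) set" where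
  "saddle_subdifferential L x y =
     subdifferential (\<lambda>x'. L x' y) x \<times> superdifferential (\<lambda>y'. L x y') y"


section \<open>Metric subregularity\<close>

text \<open>The distance to the empty set has to be \<open>\<infinity>\<close>, whereas \<^const>\<open>infdist\<close> returns \<open>0\<close> there.\<close>

definition set_edist :: "'a::metric_space \<Rightarrow> 'a set \<Rightarrow> ereal" where
  "set_edist x S = (INF y\<in>S. ereal (dist x y))"

text \<open>In \<^typ>\<open>ereal\<close> we have \<open>0 * \<infinity> = 0\<close>; since the modulus may always be increased, the
  notion does not depend on this convention.\<close>

definition metrically_subregular ::
    "('a::metric_space \<Rightarrow> 'b::metric_space set) \<Rightarrow> 'a \<Rightarrow> 'b \<Rightarrow> bool" where
  "metrically_subregular F xb yb \<longleftrightarrow>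
     yb \<in> F xb \<and>
     (\<exists>\<kappa>::real. \<kappa> \<ge> 0 \<and> (\<exists>U V. xb \<in> interior U \<and> yb \<in> interior V \<and>
        (\<forall>x\<in>U. set_edist x {x'. yb \<in> F x'} \<le> ereal \<kappa> * set_edist yb (F x \<inter> V))))"


section \<open>Forward differences on a pixel grid\<close>

definition pixel_grid :: "nat \<Rightarrow> nat \<Rightarrow> (nat \<times> nat) set" where
  "pixel_grid N1 N2 = {..<N1} \<times> {..<N2}"

text \<open>Images and their difference quotients are vectors, so the pixels are enumerated: \<open>r\<close> and
  \<open>c\<close> give the pixels belonging to the row and column indices of the matrices, and \<open>s\<close> sends a
  pixel to its successor in the direction of the difference. Rows whose successor pixel lies
  outside the grid vanish (homogeneous Neumann boundary condition).\<close>

definition forward_diff :: "(nat \<times> nat) set \<Rightarrow> (nat \<times> nat \<Rightarrow> nat \<times> nat) \<Rightarrow>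
    ('m::finite \<Rightarrow> nat \<times> nat) \<Rightarrow> ('n::finite \<Rightarrow> nat \<times> nat) \<Rightarrow> real^'n^'m" where
  "forward_diff G s r c =
     (\<chi> i k. if s (r i) \<in> G then of_bool (c k = s (r i)) - of_bool (c k = r i) else 0)"

definition forward_diff1 :: "nat \<Rightarrow> nat \<Rightarrow>
    ('m::finite \<Rightarrow> nat \<times> nat) \<Rightarrow> ('n::finite \<Rightarrow> nat \<times> nat) \<Rightarrow> real^'n^'m" where
  "forward_diff1 N1 N2 = forward_diff (pixel_grid N1 N2) (\<lambda>(a, b). (Suc a, b))"

definition forward_diff2 :: "nat \<Rightarrow> nat \<Rightarrow>
    ('m::finite \<Rightarrow> nat \<times> nat) \<Rightarrow> ('n::finite \<Rightarrow> nat \<times> nat) \<Rightarrow> real^'n^'m" where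
  "forward_diff2 N1 N2 = forward_diff (pixel_grid N1 N2) (\<lambda>(a, b). (a, Suc b))"

lemma forward_diff_mult:
  fixes r :: "'m::finite \<Rightarrow> nat \<times> nat" and c :: "'n::finite \<Rightarrow> nat \<times> nat" and u :: "real^'n"
  assumes "inj c" and "c j = r i"
  shows "c k = s (r i) \<Longrightarrow> s (r i) \<in> G \<Longrightarrow> (forward_diff G s r c *v u) $ i = u $ k - u $ j"
    and "s (r i) \<notin> G \<Longrightarrow> (forward_diff G s r c *v u) $ i = 0"
proof -
  show "(forward_diff G s r c *v u) $ i = u $ k - u $ j" if "c k = s (r i)" "s (r i) \<in> G"
  proof -
    have "c l = s (r i) \<longleftrightarrow> l = k" "c l = r i \<longleftrightarrow> l = j" for l
      using assms that(1) by (metis injD)+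
    then show ?thesis
      using that(2) by (simp add: forward_diff_def matrix_vector_mult_def left_diff_distrib
          sum_subtractf of_bool_def if_distrib[of "\<lambda>x. x * _"] cong: if_cong)
  qed
  show "(forward_diff G s r c *v u) $ i = 0" if "s (r i) \<notin> G"
    using that by (simp add: forward_diff_def matrix_vector_mult_def)
qed


section \<open>The anisotropic ROF model\<close>

text \<open>\<open>\<real>\<^sup>2\<^sup>m\<close> is rendered as \<^typ>\<open>real^2^'m\<close>, with blocks \<open>p $ i\<close>; its norm, inner product and
  those of the product types are the Euclidean ones.\<close>

definition grad :: "real^'n^'m \<Rightarrow> real^'n^'m \<Rightarrow> real^'n \<Rightarrow> real^2^'m" where
  "grad D1 D2 u = (\<chi> i. vector [(D1 *v u) $ i, (D2 *v u) $ i])"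

definition aniso_norm :: "real^2^'m \<Rightarrow> real" where
  "aniso_norm p = (\<Sum>i\<in>UNIV. \<bar>p $ i $ 1\<bar> + \<bar>p $ i $ 2\<bar>)"

definition rof_lagrangian :: "real^'n^'m \<Rightarrow> real^'n^'m \<Rightarrow> real \<Rightarrow> real^'n \<Rightarrow>
    (real^'n) \<times> (real^2^'m) \<Rightarrow> real^2^'m \<Rightarrow> real" where
  "rof_lagrangian D1 D2 \<alpha> z = (\<lambda>(u, p) lam.
     1/2 * (u \<bullet> u) - u \<bullet> z + 1/2 * (norm z)\<^sup>2 + \<alpha> * aniso_norm p + (grad D1 D2 u - p) \<bullet> lam)"

definition rof_KKT_operator :: "real^'n^'m \<Rightarrow> real^'n^'m \<Rightarrow> real \<Rightarrow> real^'n \<Rightarrow>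
    (real^'n) \<times> (real^2^'m) \<times> (real^2^'m) \<Rightarrow> ((real^'n) \<times> (real^2^'m) \<times> (real^2^'m)) set" where
  "rof_KKT_operator D1 D2 \<alpha> z = (\<lambda>(u, p, lam).
     {(u', p', lam'). ((u', p'), - lam') \<in>
        saddle_subdifferential (rof_lagrangian D1 D2 \<alpha> z) (u, p) lam})"

end

theory Submission
  imports Defs
begin

text \<open>Near the solution the signs of the nonzero entries of \<open>pb\<close> are frozen. Hence the shifted
  multiplier \<open>lam + p'\<close> of a perturbed KKT point lies in a fixed box, namely the
  subdifferential of \<open>\<alpha>\<parallel>\<cdot>\<parallel>\<^sub>1\<close> at \<open>pb\<close>, and violates only the linear equation
  \<open>\<nabla>\<^sup>* lam = z - ub\<close> that cuts the solution multipliers out of this box. Hoffman's error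
  bound controls the distance of \<open>lam\<close> to the solution multipliers by the size \<open>e\<close> of the
  perturbation plus \<open>\<parallel>u - ub\<parallel>\<close>. Inserting the nearest solution multiplier into the
  monotonicity inequality gives \<open>\<parallel>u - ub\<parallel>\<^sup>2 \<le> a * e * \<parallel>u - ub\<parallel> + b * e\<^sup>2\<close>, so
  \<open>\<parallel>u - ub\<parallel>\<close> is of order \<open>e\<close>, and then so are the other two distances.\<close>

section \<open>Hoffman's error bound for polyhedra\<close>

text \<open>If \<open>y\<close> is the point of the solution set nearest to \<open>x\<close>, then \<open>x - y\<close> lies in a
  closed cone that depends only on the constraints active at \<open>y\<close> and meets the kernel of \<open>A\<close>
  only in \<open>0\<close>. There are finitely many such cones, so compactness of the unit sphere yields
  the constant.\<close>

lemma hoffman_error_bound: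
  fixes A :: "'a::euclidean_space \<Rightarrow> 'b::real_normed_vector"
  assumes A: "bounded_linear A" and P: "polyhedron P" and ex: "x0 \<in> P" "A x0 = b"
  obtains C where "C > 0"
    "\<And>x. x \<in> P \<Longrightarrow> \<exists>y\<in>P. A y = b \<and> norm (x - y) \<le> C * norm (A x - b)"
proof -
  interpret A: bounded_linear A by fact
  obtain F where F: "finite F" "P = \<Inter>F" and "\<forall>h\<in>F. \<exists>a \<beta>. a \<noteq> 0 \<and> h = {x. a \<bullet> x \<le> \<beta>}"
    using P unfolding polyhedron_def by blast
  then obtain a \<beta> where h: "\<And>h. h \<in> F \<Longrightarrow> h = {x. a h \<bullet> x \<le> \<beta> h}"
    by metis
  have P_iff: "x \<in> P \<longleftrightarrow> (\<forall>h\<in>F. a h \<bullet> x \<le> \<beta> h)" for x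
    using F(2) h by blast
  \<comment> \<open>\<open>T I\<close> is the tangent cone of the solution set at a point whose
    active constraints are \<open>I\<close>. \<open>D I\<close> collects the unit vectors that
    respect these constraints and lie in the polar cone of \<open>T I\<close>, as the direction from
    a projection to a point of \<open>P\<close> does.\<close>
  define T where "T I = {w. A w = 0 \<and> (\<forall>h\<in>I. a h \<bullet> w \<le> 0)}" for I
  define D where
    "D I = sphere 0 1 \<inter> ((\<Inter>h\<in>I. {d. a h \<bullet> d \<le> 0}) \<inter> (\<Inter>w\<in>T I. {d. w \<bullet> d \<le> 0}))" for I
  have "\<exists>c>0. \<forall>d\<in>D I. c \<le> norm (A d)" for I
  proof (cases "D I = {}")
    case True
    then show ?thesis by (auto intro: exI[of _ 1])
  next
    case False
    have "compact (D I)"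
      unfolding D_def
      by (intro compact_Int_closed compact_sphere closed_Int closed_INT ballI closed_halfspace_le)
    moreover have "continuous_on (D I) (\<lambda>d. norm (A d))"
      by (intro continuous_intros A.continuous_on)
    ultimately obtain d where d: "d \<in> D I" "\<forall>d'\<in>D I. norm (A d) \<le> norm (A d')"
      using continuous_attains_inf[OF _ False] by blast
    \<comment> \<open>A kernel direction \<open>d\<close> would lie in \<open>T I\<close>, and
      polarity then tests it against itself.\<close>
    have "A d \<noteq> 0"
    proof
      assume "A d = 0"
      then have "d \<in> T I"
        using d(1) by (auto simp: T_def D_def)
      then have "d \<bullet> d \<le> 0" and "norm d = 1"
        using d(1) by (auto simp: D_def)
      then show False by (simp add: power2_norm_eq_inner[symmetric])
    qed
    then show ?thesis
      using d(2) by (intro exI[of _ "norm (A d)"]) auto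
  qed
  then obtain c where c: "\<And>I. c I > (0::real)" "\<And>I d. d \<in> D I \<Longrightarrow> c I \<le> norm (A d)"
    by metis
  define c0 where "c0 = Min (c ` Pow F)"
  have fin: "finite (c ` Pow F)" "c ` Pow F \<noteq> {}"
    using F(1) by auto
  have c0: "c0 > 0"
    unfolding c0_def using c(1) by (subst Min_gr_iff[OF fin]) auto
  have c0_le: "c0 \<le> norm (A d)" if "I \<subseteq> F" "d \<in> D I" for I d
  proof -
    have "c0 \<le> c I"
      unfolding c0_def using that fin by (intro Min_le) auto
    with c(2)[OF that(2)] show ?thesis by linarith
  qed
  define L where "L = P \<inter> {y. A y = b}"
  have "closed {y. A y = b}"
    by (intro closed_Collect_eq continuous_intros A.continuous_on)
  then have L: "closed L" "convex L" "L \<noteq> {}"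
    using polyhedron_imp_closed[OF P] polyhedron_imp_convex[OF P] ex
    by (auto simp: L_def convex_def A.add A.scaleR simp flip: scaleR_add_left)
  show thesis
  proof
    show "1 / c0 > 0"
      using c0 by simp
  next
    fix x assume x: "x \<in> P"
    define y where "y = closest_point L x"
    have y: "y \<in> P" "A y = b"
      using closest_point_in_set[OF L(1,3), of x] by (auto simp: y_def L_def)
    have "norm (x - y) \<le> 1 / c0 * norm (A x - b)"
    proof (cases "x = y")
      case True
      then show ?thesis using c0 by simp
    next
      case False
      define I where "I = {h\<in>F. a h \<bullet> y = \<beta> h}"
      have feasible: "a h \<bullet> (x - y) \<le> 0" if "h \<in> I" for h
        using that x by (auto simp: I_def P_iff inner_diff_right)
      \<comment> \<open>A small step along \<open>w\<close> from \<open>y\<close> stays in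
        \<open>L\<close>: active constraints do not grow and inactive ones have slack. The
        variational inequality of the projection then gives the sign.\<close>
      have normal: "w \<bullet> (x - y) \<le> 0" if w: "w \<in> T I" for w
      proof -
        have "\<forall>\<^sub>F t in at_right 0. a h \<bullet> (y + t *\<^sub>R w) \<le> \<beta> h" if hF: "h \<in> F" for h
        proof (cases "h \<in> I")
          case True
          then have "a h \<bullet> w \<le> 0" "a h \<bullet> y = \<beta> h"
            using w by (auto simp: T_def I_def)
          then show ?thesis
            by (auto simp: eventually_at_filter inner_add_right mult_nonneg_nonpos)
        next
          case False
          then have "a h \<bullet> y < \<beta> h"
            using y(1) hF by (force simp: P_iff I_def)
          moreover have "((\<lambda>t. a h \<bullet> (y + t *\<^sub>R w)) \<longlongrightarrow> a h \<bullet> (y + 0 *\<^sub>R w)) (at_right 0)"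
            by (intro tendsto_intros)
          ultimately have "\<forall>\<^sub>F t in at_right 0. a h \<bullet> (y + t *\<^sub>R w) < \<beta> h"
            by (intro order_tendstoD(2)) auto
          then show ?thesis
            by eventually_elim simp
        qed
        then have "\<forall>\<^sub>F t in at_right 0. \<forall>h\<in>F. a h \<bullet> (y + t *\<^sub>R w) \<le> \<beta> h"
          using F(1) by (intro eventually_ball_finite) auto
        with eventually_at_right_less[of "0::real"]
        have "\<forall>\<^sub>F t in at_right 0. t > 0 \<and> y + t *\<^sub>R w \<in> L"
          by eventually_elim (use w y in \<open>auto simp: L_def P_iff T_def A.add A.scaleR\<close>)
        then obtain t where t: "t > 0" "y + t *\<^sub>R w \<in> L"
          by (metis (no_types, lifting) eventually_happens trivial_limit_at_right_real)
        have "(x - y) \<bullet> (y + t *\<^sub>R w - y) \<le> 0"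
          using closest_point_dot[OF L(2,1) t(2), of x] by (simp add: y_def)
        with t(1) show ?thesis
          by (simp add: mult_le_0_iff inner_commute)
      qed
      define d where "d = (x - y) /\<^sub>R norm (x - y)"
      have "d \<in> D I"
        using feasible normal False by (auto simp: D_def d_def mult_le_0_iff)
      then have "c0 \<le> norm (A d)"
        by (intro c0_le[of I]) (auto simp: I_def)
      also have "\<dots> = norm (A x - b) / norm (x - y)"
        by (simp add: d_def A.scaleR A.diff y(2) divide_inverse)
      finally show ?thesis
        using False c0 by (simp add: field_simps)
    qed
    with y show "\<exists>y\<in>P. A y = b \<and> norm (x - y) \<le> 1 / c0 * norm (A x - b)"
      by blast
  qed
qed

section \<open>Metric subregularity from an estimate for single residuals\<close>

lemma metrically_subregularI:
  assumes "y \<in> F x" "\<kappa> > 0" "open U" "x \<in> U"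
    and bound: "\<And>x' y'. x' \<in> U \<Longrightarrow> y' \<in> F x' \<Longrightarrow> \<exists>w. y \<in> F w \<and> dist x' w \<le> \<kappa> * dist y y'"
  shows "metrically_subregular F x y"
proof -
  have "set_edist x' {w. y \<in> F w} \<le> ereal \<kappa> * set_edist y (F x' \<inter> UNIV)" if x': "x' \<in> U" for x'
  proof -
    \<comment> \<open>Dividing by \<kappa> turns the claim into a lower bound on an infimum, which
      can be checked for one residual \<open>y'\<close> at a time; an empty \<open>F x'\<close>
      gives \<infinity> and costs nothing. The bound covers residuals of any size, hence the choice
      \<open>UNIV\<close> for \<open>V\<close>.\<close>
    have "set_edist x' {w. y \<in> F w} / ereal \<kappa> \<le> set_edist y (F x')"
      unfolding set_edist_def[of y]
    proof (rule INF_greatest)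
      fix y' assume "y' \<in> F x'"
      then obtain w where w: "y \<in> F w" "dist x' w \<le> \<kappa> * dist y y'"
        using bound x' by blast
      have "set_edist x' {w. y \<in> F w} \<le> ereal (dist x' w)"
        unfolding set_edist_def using w(1) by (intro INF_lower) auto
      also have "\<dots> \<le> ereal \<kappa> * ereal (dist y y')"
        using w(2) by simp
      finally show "set_edist x' {w. y \<in> F w} / ereal \<kappa> \<le> ereal (dist y y')"
        using \<open>\<kappa> > 0\<close> by (simp add: ereal_divide_le_pos)
    qed
    then show ?thesis
      using \<open>\<kappa> > 0\<close> by (simp add: ereal_divide_le_pos)
  qed
  then show ?thesis
    unfolding metrically_subregular_def using assms(1-4)
    by (intro conjI exI[of _ \<kappa>] exI[of _ U] exI[of _ UNIV]) (auto simp: interior_open)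
qed

section \<open>The gradient and the subdifferential of the anisotropic norm\<close>

lemma linear_grad: "linear (grad D1 D2)"
proof (rule linearI)
  show "grad D1 D2 (x + y) = grad D1 D2 x + grad D1 D2 y" for x y
    by (simp add: grad_def vec_eq_iff forall_2 matrix_vector_right_distrib)
  show "grad D1 D2 (t *\<^sub>R x) = t *\<^sub>R grad D1 D2 x" for t x
    by (simp add: grad_def vec_eq_iff forall_2 matrix_vector_mult_scaleR)
qed

lemma inner_real2_vec: "(v::real^2^'m) \<bullet> p = (\<Sum>i\<in>UNIV. \<Sum>j\<in>UNIV. v $ i $ j * p $ i $ j)"
  by (simp add: inner_vec_def)

lemma aniso_norm_eq: "aniso_norm p = (\<Sum>i\<in>UNIV. \<Sum>j\<in>UNIV. \<bar>p $ i $ j\<bar>)"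
  by (simp add: aniso_norm_def sum_2)

lemma aniso_norm_add_axis:
  "aniso_norm (p + axis i (axis j t)) = aniso_norm p + (\<bar>p $ i $ j + t\<bar> - \<bar>p $ i $ j\<bar>)"
proof -
  have "\<bar>(p + axis i (axis j t)) $ k $ l\<bar> =
      \<bar>p $ k $ l\<bar> + (if l = j then if k = i then \<bar>p $ i $ j + t\<bar> - \<bar>p $ i $ j\<bar> else 0 else 0)" for k l
    by (auto simp: axis_def)
  then show ?thesis
    by (simp add: aniso_norm_eq sum.distrib)
qed

text \<open>The norm is a sum over coordinates and positively homogeneous, so the subgradient
  inequality reduces to dual feasibility and complementarity in each coordinate.\<close>

lemma subdifferential_aniso_norm:
  assumes "\<alpha> > 0"
  shows "v \<in> subdifferential (\<lambda>p. \<alpha> * aniso_norm p) p \<longleftrightarrow>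
    (\<forall>i j. \<bar>v $ i $ j\<bar> \<le> \<alpha> \<and> v $ i $ j * p $ i $ j = \<alpha> * \<bar>p $ i $ j\<bar>)"
proof
  assume v: "v \<in> subdifferential (\<lambda>p. \<alpha> * aniso_norm p) p"
  show "\<forall>i j. \<bar>v $ i $ j\<bar> \<le> \<alpha> \<and> v $ i $ j * p $ i $ j = \<alpha> * \<bar>p $ i $ j\<bar>"
  proof (intro allI)
    fix i j
    let ?v = "v $ i $ j" and ?p = "p $ i $ j"
    have sub: "\<alpha> * \<bar>?p + t\<bar> \<ge> \<alpha> * \<bar>?p\<bar> + ?v * t" for t
    proof -
      have "\<alpha> * aniso_norm (p + axis i (axis j t)) \<ge> \<alpha> * aniso_norm p + v \<bullet> axis i (axis j t)"
        using v by (auto simp: subdifferential_def dest: spec[of _ "p + axis i (axis j t)"])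
      then show ?thesis
        by (simp add: aniso_norm_add_axis inner_axis algebra_simps)
    qed
    \<comment> \<open>\<open>t = ?p\<close> doubles the coordinate and \<open>t = - ?p\<close>
      removes it, which gives the two inequalities. For the bound on \<open>?v\<close> the
      coordinate is moved to 1 and to -1.\<close>
    have "?v * ?p = \<alpha> * \<bar>?p\<bar>"
      using sub[of "?p"] sub[of "- ?p"] by (simp add: abs_mult flip: mult_2)
    moreover have "\<bar>?v\<bar> \<le> \<alpha>"
      using sub[of "1 - ?p"] sub[of "- 1 - ?p"] calculation by (simp add: algebra_simps)
    ultimately show "\<bar>?v\<bar> \<le> \<alpha> \<and> ?v * ?p = \<alpha> * \<bar>?p\<bar>" by simp
  qed
next
  assume v: "\<forall>i j. \<bar>v $ i $ j\<bar> \<le> \<alpha> \<and> v $ i $ j * p $ i $ j = \<alpha> * \<bar>p $ i $ j\<bar>"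
  have "v \<bullet> q \<le> \<alpha> * aniso_norm q" for q
    unfolding inner_real2_vec aniso_norm_eq sum_distrib_left
  proof (intro sum_mono)
    fix i j
    have "v $ i $ j * q $ i $ j \<le> \<bar>v $ i $ j\<bar> * \<bar>q $ i $ j\<bar>"
      by (simp flip: abs_mult)
    also have "\<dots> \<le> \<alpha> * \<bar>q $ i $ j\<bar>"
      using v by (intro mult_right_mono) auto
    finally show "v $ i $ j * q $ i $ j \<le> \<alpha> * \<bar>q $ i $ j\<bar>" .
  qed
  moreover have "v \<bullet> p = \<alpha> * aniso_norm p"
    using v by (simp add: inner_real2_vec aniso_norm_eq sum_distrib_left)
  ultimately show "v \<in> subdifferential (\<lambda>p. \<alpha> * aniso_norm p) p"
    by (simp add: subdifferential_def inner_diff_right)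
qed

text \<open>By the sign of \<open>p $ i $ j\<close>, each coordinate ranges over the point \<alpha>,
  the point -\<alpha> or the whole interval between them. The box form supplies the polyhedron
  required by the error bound.\<close>

lemma subdifferential_aniso_norm_cbox:
  assumes "\<alpha> > 0"
  obtains lo hi where "subdifferential (\<lambda>p. \<alpha> * aniso_norm p) p = cbox lo hi"
proof
  define lo :: "real^2^'a" where "lo = (\<chi> i j. if p $ i $ j > 0 then \<alpha> else - \<alpha>)"
  define hi :: "real^2^'a" where "hi = (\<chi> i j. if p $ i $ j < 0 then - \<alpha> else \<alpha>)"
  have "x * t = - (\<alpha> * t) \<longleftrightarrow> t = 0 \<or> x = - \<alpha>" for x t :: real
    using mult_cancel_right[of x t "- \<alpha>"] by auto
  then have "(\<bar>x\<bar> \<le> \<alpha> \<and> x * t = \<alpha> * \<bar>t\<bar>) \<longleftrightarrow>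
      ((if t > 0 then \<alpha> else - \<alpha>) \<le> x \<and> x \<le> (if t < 0 then - \<alpha> else \<alpha>))" for x t :: real
    using assms by (cases t "0::real" rule: linorder_cases) (auto simp: abs_if split: if_splits)
  then show "subdifferential (\<lambda>p. \<alpha> * aniso_norm p) p = cbox lo hi"
    by (auto simp: subdifferential_aniso_norm[OF assms] mem_box Basis_vec_def inner_axis
        lo_def hi_def)
qed

text \<open>Away from 0 the subdifferential of the absolute value depends only on the sign, and at 0
  it is largest. Here \<open>q\<close> will be \<open>pb\<close>, whose zero entries may have become
  nonzero in the nearby \<open>p\<close>.\<close>

lemma subdifferential_aniso_norm_same_sign:
  assumes "\<alpha> > 0" and "\<And>i j. q $ i $ j = 0 \<or> q $ i $ j * p $ i $ j > 0"
  shows "subdifferential (\<lambda>p. \<alpha> * aniso_norm p) p \<subseteq> subdifferential (\<lambda>p. \<alpha> * aniso_norm p) q"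
proof
  fix v assume v: "v \<in> subdifferential (\<lambda>p. \<alpha> * aniso_norm p) p"
  have "v $ i $ j * q $ i $ j = \<alpha> * \<bar>q $ i $ j\<bar>" for i j
  proof -
    have "v $ i $ j * p $ i $ j = \<alpha> * \<bar>p $ i $ j\<bar>"
      using v by (simp add: subdifferential_aniso_norm[OF assms(1)])
    moreover have "v $ i $ j * p $ i $ j = - \<alpha> * p $ i $ j \<longleftrightarrow> v $ i $ j = - \<alpha> \<or> p $ i $ j = 0"
      by (metis mult_cancel_right)
    ultimately show ?thesis
      using assms(2)[of i j] by (auto simp: zero_less_mult_iff abs_if)
  qed
  with v show "v \<in> subdifferential (\<lambda>p. \<alpha> * aniso_norm p) q"
    by (simp add: subdifferential_aniso_norm[OF assms(1)])
qed

section \<open>The KKT operator in explicit form\<close>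

lemma mem_rof_KKT_operator:
  "(u', p', lam') \<in> rof_KKT_operator D1 D2 \<alpha> z (u, p, lam) \<longleftrightarrow>
     u' = u - z + adjoint (grad D1 D2) lam \<and>
     p' + lam \<in> subdifferential (\<lambda>p. \<alpha> * aniso_norm p) p \<and>
     lam' = p - grad D1 D2 u" (is "?L \<longleftrightarrow> ?R")
proof -
  let ?G = "grad D1 D2" and ?l = "rof_lagrangian D1 D2 \<alpha> z"
  have adj: "?G x \<bullet> y = x \<bullet> adjoint ?G y" for x y
    by (simp add: adjoint_works linear_grad)
  \<comment> \<open>The gap to the affine function with slope \<open>(u', p')\<close> splits into a
    quadratic and a linear term in \<open>y - u\<close> and a subgradient gap of the norm. The term
    \<open>- p\<close> in the constraint is what shifts \<open>p'\<close> by
    \<open>lam\<close>.\<close>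
  have expand: "?l (y, q) lam - (?l (u, p) lam + (u', p') \<bullet> ((y, q) - (u, p))) =
      1/2 * ((y - u) \<bullet> (y - u)) + (u - z + adjoint ?G lam - u') \<bullet> (y - u)
      + (\<alpha> * aniso_norm q - (\<alpha> * aniso_norm p + (p' + lam) \<bullet> (q - p)))" for y q
    by (simp add: rof_lagrangian_def adj inner_diff_left inner_diff_right inner_add_left)
       (simp add: inner_commute field_simps)
  have sup: "- lam' \<in> superdifferential (?l (u, p)) lam \<longleftrightarrow> lam' = p - ?G u"
  proof -
    let ?d = "lam' - (p - ?G u)"
    have "?l (u, p) \<mu> \<le> ?l (u, p) lam + - lam' \<bullet> (\<mu> - lam) \<longleftrightarrow> ?d \<bullet> (\<mu> - lam) \<le> 0" for \<mu>
      by (simp add: rof_lagrangian_def algebra_simps)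
    then have iff: "- lam' \<in> superdifferential (?l (u, p)) lam \<longleftrightarrow> (\<forall>\<mu>. ?d \<bullet> (\<mu> - lam) \<le> 0)"
      unfolding superdifferential_def mem_Collect_eq by blast
    \<comment> \<open>The Lagrangian is affine in \<open>lam\<close>, so a step along
      \<open>?d\<close> itself determines the slope.\<close>
    have "?d = 0" if "\<forall>\<mu>. ?d \<bullet> (\<mu> - lam) \<le> 0"
    proof -
      have "?d \<bullet> ?d \<le> 0"
        using that[rule_format, of "lam + ?d"] by simp
      then show ?thesis
        by (metis inner_eq_zero_iff inner_ge_zero order_antisym)
    qed
    moreover have "\<forall>\<mu>. ?d \<bullet> (\<mu> - lam) \<le> 0" if "?d = 0"
      unfolding that by simp
    ultimately show ?thesis
      unfolding iff by (metis eq_iff_diff_eq_0)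
  qed
  have sub: "(u', p') \<in> subdifferential (\<lambda>x. ?l x lam) (u, p) \<longleftrightarrow>
      u' = u - z + adjoint ?G lam \<and> p' + lam \<in> subdifferential (\<lambda>p. \<alpha> * aniso_norm p) p"
    (is "?S \<longleftrightarrow> _")
  proof
    assume ?S
    then have ge: "0 \<le> 1/2 * ((y - u) \<bullet> (y - u)) + (u - z + adjoint ?G lam - u') \<bullet> (y - u)
      + (\<alpha> * aniso_norm q - (\<alpha> * aniso_norm p + (p' + lam) \<bullet> (q - p)))" for y q
      unfolding expand[symmetric] by (simp add: subdifferential_def del: inner_Pair)
    \<comment> \<open>The step \<open>- ?w\<close> in \<open>u\<close> with \<open>q = p\<close>
      leaves \<open>- 1/2 * (?w \<bullet> ?w)\<close>, so the slope vanishes. Taking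
      \<open>y = u\<close> afterwards isolates the part in \<open>p\<close>.\<close>
    have "u - z + adjoint ?G lam - u' = 0" (is "?w = 0")
    proof -
      have "0 \<le> 1/2 * (?w \<bullet> ?w) - ?w \<bullet> ?w"
        using ge[of "u + - ?w" p] unfolding add_diff_cancel_left' by (simp only: inner_minus_left
            inner_minus_right minus_minus diff_self inner_zero_right add_0_right add_uminus_conv_diff)
      then have "?w \<bullet> ?w \<le> 0" by linarith
      then show ?thesis
        by (metis inner_eq_zero_iff inner_ge_zero order_antisym)
    qed
    moreover have "p' + lam \<in> subdifferential (\<lambda>p. \<alpha> * aniso_norm p) p"
      using ge[of u] by (simp add: subdifferential_def)
    ultimately show "u' = u - z + adjoint ?G lam \<and>
        p' + lam \<in> subdifferential (\<lambda>p. \<alpha> * aniso_norm p) p"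
      by simp
  next
    assume R: "u' = u - z + adjoint ?G lam \<and>
        p' + lam \<in> subdifferential (\<lambda>p. \<alpha> * aniso_norm p) p"
    have "0 \<le> ?l (y, q) lam - (?l (u, p) lam + (u', p') \<bullet> ((y, q) - (u, p)))" for y q
      unfolding expand using R by (simp add: subdifferential_def)
    then show ?S
      by (simp add: subdifferential_def del: inner_Pair)
  qed
  show ?thesis
    by (simp add: rof_KKT_operator_def saddle_subdifferential_def sub sup conj_assoc)
qed

section \<open>Monotonicity and a quadratic inequality\<close>

lemma subdifferential_monotone:
  assumes "v \<in> subdifferential f x" "w \<in> subdifferential f y"
  shows "0 \<le> (v - w) \<bullet> (x - y)"
proof -
  have "f y \<ge> f x + v \<bullet> (y - x)" "f x \<ge> f y + w \<bullet> (x - y)"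
    using assms by (auto simp: subdifferential_def)
  then show ?thesis
    by (simp add: algebra_simps)
qed

text \<open>If \<open>X\<close> exceeds \<open>e\<close>, then \<open>e * e \<le> e * X\<close> and
  a factor \<open>X\<close> cancels; otherwise \<open>1 \<le> a\<close> settles the claim.\<close>

lemma le_of_square_le:
  fixes X e :: real
  assumes "0 \<le> X" "0 \<le> e" "1 \<le> a" "0 \<le> b" and sq: "X\<^sup>2 \<le> a * e * X + b * e\<^sup>2"
  shows "X \<le> (a + b) * e"
proof (cases "X \<le> e")
  case True
  have "1 * e \<le> (a + b) * e"
    using assms by (intro mult_right_mono) auto
  with True show ?thesis by simp
next
  case False
  have "b * e\<^sup>2 \<le> b * (e * X)"
    using False assms by (auto simp: power2_eq_square intro!: mult_left_mono)
  with sq have "X * X \<le> ((a + b) * e) * X"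
    by (simp add: power2_eq_square algebra_simps)
  with False assms show ?thesis by auto
qed

section \<open>Subregularity of the KKT operator\<close>

theorem theorem2:
  fixes N1 N2 :: nat
    and r :: "'m::finite \<Rightarrow> nat \<times> nat" and c :: "'n::finite \<Rightarrow> nat \<times> nat"
    and D1 D2 :: "real^'n^'m"
    and \<alpha> :: real and z ub :: "real^'n" and pb lamb :: "real^2^'m"
  assumes "bij_betw r UNIV (pixel_grid N1 N2)"
    and "bij_betw c UNIV (pixel_grid N1 N2)"
    and "D1 = forward_diff1 N1 N2 r c"
    and "D2 = forward_diff2 N1 N2 r c"
    and "\<alpha> > 0"
    and "0 \<in> rof_KKT_operator D1 D2 \<alpha> z (ub, pb, lamb)"
  shows "metrically_subregular (rof_KKT_operator D1 D2 \<alpha> z) (ub, pb, lamb) 0"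
proof -
  define G where "G = grad D1 D2"
  define S where "S p = subdifferential (\<lambda>p. \<alpha> * aniso_norm p) p" for p :: "real^2^'m"
  have KKT: "(u', p', lam') \<in> rof_KKT_operator D1 D2 \<alpha> z (u, p, lam) \<longleftrightarrow>
      u' = u - z + adjoint G lam \<and> p' + lam \<in> S p \<and> lam' = p - G u" for u' p' lam' u p lam
    by (simp add: mem_rof_KKT_operator G_def S_def)
  have G: "linear G" and adjG: "linear (adjoint G)"
    by (simp_all add: G_def linear_grad adjoint_linear)
  have adj: "adjoint G y \<bullet> x = G x \<bullet> y" for x y
    by (metis adjoint_works inner_commute G)
  obtain K1 K2 where K12: "\<And>x. norm (G x) \<le> K1 * norm x" "\<And>y. norm (adjoint G y) \<le> K2 * norm y"
    using linear_bounded[OF G] linear_bounded[OF adjG] by blast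
  define K where "K = max 0 (max K1 K2)"
  have "K1 * norm x \<le> K * norm x" "K2 * norm y \<le> K * norm y"
    for x :: "real^'n" and y :: "real^2^'m"
    by (auto simp: K_def intro: mult_right_mono)
  with K12 have K: "norm (G x) \<le> K * norm x" "norm (adjoint G y) \<le> K * norm y" for x y
    by (blast intro: order_trans)+
  have K_nonneg: "K \<ge> 0"
    by (simp add: K_def)
  have solb: "ub - z + adjoint G lamb = 0" "lamb \<in> S pb" "pb = G ub"
    using assms(6) unfolding zero_prod_def KKT by auto
  \<comment> \<open>Only the multiplier is replaced, so \<open>(ub, pb, \<mu>)\<close> can serve as
    the comparison point in the solution set.\<close>
  have sol: "(0, 0, 0) \<in> rof_KKT_operator D1 D2 \<alpha> z (ub, pb, \<mu>)"
    if "\<mu> \<in> S pb" "adjoint G \<mu> = z - ub" for \<mu>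
    using that solb(3) by (simp add: KKT)
  obtain lo hi where "S pb = cbox lo hi"
    using subdifferential_aniso_norm_cbox[OF assms(5)] unfolding S_def by blast
  then have "polyhedron (S pb)"
    by (simp add: polytope_imp_polyhedron polytope_interval)
  moreover have "adjoint G lamb = z - ub"
    using solb(1) by (simp add: algebra_simps add_eq_0_iff)
  ultimately obtain C where C: "C > 0"
    "\<And>v. v \<in> S pb \<Longrightarrow> \<exists>\<mu>\<in>S pb. adjoint G \<mu> = z - ub \<and>
        norm (v - \<mu>) \<le> C * norm (adjoint G v - (z - ub))"
    using hoffman_error_bound[of "adjoint G" "S pb" lamb "z - ub"] adjG solb(2)
    by (metis linear_conv_bounded_linear)
  \<comment> \<open>Only the signs of those entries of \<open>p\<close> are prescribed where
    \<open>pb\<close> is nonzero, which is an open condition; \<open>u\<close> and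
    \<open>lam\<close> are unrestricted.\<close>
  define U :: "((real^'n) \<times> (real^2^'m) \<times> (real^2^'m)) set" where
    "U = (\<Inter>i. \<Inter>j. {x. pb $ i $ j = 0 \<or> 0 < pb $ i $ j * fst (snd x) $ i $ j})"
  \<comment> \<open>\<open>M\<close> is the sum of the two coefficients to which
    \<open>le_of_square_le\<close> is applied; the three summands of \<kappa> bound the
    \<open>u\<close>, \<open>p\<close> and \<open>lam\<close> parts of the distance.\<close>
  define M where "M = (1 + K + C) + (2 + C * (K + 1))"
  define \<kappa> where "\<kappa> = M + (1 + K * M) + (1 + C * (K + 1 + M))"
  have M: "M > 0"
    using K_nonneg C(1) by (simp add: M_def add_pos_nonneg)
  show ?thesis
  proof (rule metrically_subregularI)
    show "0 \<in> rof_KKT_operator D1 D2 \<alpha> z (ub, pb, lamb)" by fact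
    show "\<kappa> > 0"
      using K_nonneg C(1) M by (simp add: \<kappa>_def add_pos_nonneg)
    show "open U"
      unfolding U_def
      by (intro open_INT finite ballI open_Collect_disj open_Collect_const open_Collect_less
          continuous_intros)
    show "(ub, pb, lamb) \<in> U"
      by (auto simp: U_def zero_less_mult_iff)
  next
    fix x y assume x: "x \<in> U" and y: "y \<in> rof_KKT_operator D1 D2 \<alpha> z x"
    obtain u p lam u' p' lam' where xy: "x = (u, p, lam)" "y = (u', p', lam')"
      by (metis prod.exhaust)
    define e where "e = norm y"
    have e: "0 \<le> e" "norm u' \<le> e" "norm p' \<le> e" "norm lam' \<le> e"
      unfolding e_def xy
      by (auto intro: order_trans[OF norm_fst_le] order_trans[OF norm_snd_le])
    have res: "u' = u - z + adjoint G lam" "p' + lam \<in> S p" "lam' = p - G u"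
      using y unfolding xy KKT by auto
    have "S p \<subseteq> S pb"
      unfolding S_def using x
      by (intro subdifferential_aniso_norm_same_sign assms(5)) (auto simp: U_def xy)
    then obtain \<mu> where \<mu>: "\<mu> \<in> S pb" "adjoint G \<mu> = z - ub"
      "norm (p' + lam - \<mu>) \<le> C * norm (adjoint G (p' + lam) - (z - ub))"
      using C(2) res(2) by blast
    define X where "X = norm (u - ub)"
    have X: "X \<ge> 0" by (simp add: X_def)
    have lin: "G (u - ub) = G u - G ub" "adjoint G (p' + lam) = adjoint G p' + adjoint G lam"
      "adjoint G (lam - \<mu>) = adjoint G lam - adjoint G \<mu>"
      using G adjG by (simp_all add: linear_diff linear_add)
    have dp: "p - pb = lam' + G (u - ub)"
      by (simp add: res(3) solb(3) lin)
    have GX: "norm (G (u - ub)) \<le> K * X"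
      using K(1) by (simp add: X_def)
    \<comment> \<open>The equation for \<open>u'\<close> turns the residual of the shifted
      multiplier into perturbation terms plus the displacement of \<open>u\<close>, the only part
      not yet known to be of order \<open>e\<close>.\<close>
    have "adjoint G (p' + lam) - (z - ub) = adjoint G p' + u' - (u - ub)"
      by (simp add: lin res(1))
    also have "norm \<dots> \<le> norm (adjoint G p') + norm u' + X"
      unfolding X_def by norm
    also have "\<dots> \<le> (K + 1) * e + X"
      using K(2)[of p'] mult_left_mono[OF e(3) K_nonneg] e(2) by (simp add: algebra_simps)
    finally have "norm (p' + lam - \<mu>) \<le> C * ((K + 1) * e + X)"
      using \<mu>(3) C(1) by (meson mult_left_mono less_imp_le order_trans)
    moreover have "norm (lam - \<mu>) \<le> norm (p' + lam - \<mu>) + norm p'"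
      by norm
    ultimately have dlam: "norm (lam - \<mu>) \<le> e + C * ((K + 1) * e + X)"
      using e(3) by linarith
    \<comment> \<open>Monotonicity compares \<open>p' + lam\<close> at \<open>p\<close> with
      \<open>\<mu>\<close> at \<open>pb\<close>. Its cross term
      \<open>(lam - \<mu>) \<bullet> G (u - ub)\<close> cancels against the one produced by the
      equation for \<open>u'\<close>.\<close>
    have "X\<^sup>2 \<le> u' \<bullet> (u - ub) + p' \<bullet> (lam' + G (u - ub)) + lam' \<bullet> (lam - \<mu>)"
    proof -
      have "0 \<le> (p' + lam - \<mu>) \<bullet> (p - pb)"
        using res(2) \<mu>(1) unfolding S_def by (rule subdifferential_monotone)
      then have "0 \<le> p' \<bullet> (lam' + G (u - ub)) + (lam - \<mu>) \<bullet> lam' + (lam - \<mu>) \<bullet> G (u - ub)"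
        by (simp add: dp algebra_simps)
      moreover have "u' = (u - ub) + adjoint G (lam - \<mu>)"
        by (simp add: res(1) lin \<mu>(2))
      then have "u' \<bullet> (u - ub) = X\<^sup>2 + G (u - ub) \<bullet> (lam - \<mu>)"
        by (simp add: inner_add_left adj X_def power2_norm_eq_inner)
      ultimately show ?thesis
        by (simp add: inner_commute)
    qed
    \<comment> \<open>Each inner product contains a factor bounded by \<open>e\<close>, so the
      unknown \<open>X\<close> enters at most linearly.\<close>
    also have "\<dots> \<le> e * X + e * (e + K * X) + e * (e + C * ((K + 1) * e + X))"
    proof (intro add_mono)
      show "u' \<bullet> (u - ub) \<le> e * X"
        unfolding X_def
        by (rule order_trans[OF norm_cauchy_schwarz]) (intro mult_right_mono e norm_ge_zero)
      have "norm (lam' + G (u - ub)) \<le> e + K * X"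
        by (rule norm_triangle_le) (intro add_mono e GX)
      then show "p' \<bullet> (lam' + G (u - ub)) \<le> e * (e + K * X)"
        by (intro order_trans[OF norm_cauchy_schwarz] mult_mono e) auto
      show "lam' \<bullet> (lam - \<mu>) \<le> e * (e + C * ((K + 1) * e + X))"
        by (intro order_trans[OF norm_cauchy_schwarz] mult_mono e dlam) auto
    qed
    also have "\<dots> = (1 + K + C) * e * X + (2 + C * (K + 1)) * e\<^sup>2"
      by (simp add: algebra_simps power2_eq_square)
    finally have XM: "X \<le> M * e"
      unfolding M_def using X e(1) K_nonneg C(1) by (intro le_of_square_le) auto
    have "dist x (ub, pb, \<mu>) \<le> norm (u - ub) + (norm (p - pb) + norm (lam - \<mu>))"
      unfolding xy dist_norm
      by (simp, meson add_left_mono norm_Pair_le order_trans)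
    also have "\<dots> \<le> M * e + ((e + K * (M * e)) + (e + C * ((K + 1) * e + M * e)))"
    proof (intro add_mono)
      show "norm (u - ub) \<le> M * e"
        using XM by (simp add: X_def)
      have "norm (p - pb) \<le> e + K * X"
        unfolding dp by (rule norm_triangle_le) (intro add_mono e GX)
      also have "\<dots> \<le> e + K * (M * e)"
        using XM K_nonneg by (intro add_left_mono mult_left_mono)
      finally show "norm (p - pb) \<le> e + K * (M * e)" .
      show "norm (lam - \<mu>) \<le> e + C * ((K + 1) * e + M * e)"
        using XM C(1) by (intro order_trans[OF dlam] add_left_mono mult_left_mono) auto
    qed
    also have "\<dots> = \<kappa> * dist 0 y"
      by (simp add: \<kappa>_def e_def algebra_simps)
    finally show "\<exists>w. 0 \<in> rof_KKT_operator D1 D2 \<alpha> z w \<and> dist x w \<le> \<kappa> * dist 0 y"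
      using sol[OF \<mu>(1,2)] unfolding zero_prod_def by blast
  qed
qed

end
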